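(* Let $g(z)=\sum_{n=0}^{\infty} b_n z^n$ be analytic in the unit disc $\mathbb{D}$. Let $\alpha<0$ and $\beta\in\mathbb{R}$. Then the following statements are equivalent: (1) The operator $\mathcal{H}_g:\mathcal{D}^2_\alpha\to\mathcal{D}^2_\beta$ is bounded. (2) The operator $\mathcal{H}_g:\mathcal{D}^2_\alpha\to\mathcal{D}^2_\beta$ is compact. (3) $\displaystyle\sum_{n=1}^\infty n^{1-\beta}|b_n|^2<\infty$.
   Context: $\mathbb{D}$ is the open unit disc of $\mathbb{C}$ and $H(\mathbb{D})$ is the space of all analytic functions in $\mathbb{D}$. For $g\in H(\mathbb{D})$ the generalized Hilbert operator is $\mathcal{H}_g(f)(z)=\int_0^1 f(t)g'(tz)\,dt$, $z\in\mathbb{D}$, for $f\in H(\mathbb{D})$ with $\int_0^1|f(t)|\,dt<\infty$ (this holds for every $f\in\mathcal{D}^2_\alpha$ when $\alpha<2$). For $\gamma\in\mathbb{R}$, $\mathcal{D}^2_\gamma$ is the space of $h(z)=\sum_{n\ge0}c_nz^n\in H(\mathbb{D})$ with $\|h\|^2_{\mathcal{D}^2_\gamma}=|c_0|^2+\sum_{n=1}^\infty n^{1-\gamma}|c_n|^2<\infty$. *)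

theory Defs
  imports "HOL-Analysis.Analysis" "HOL-Complex_Analysis.Complex_Analysis"
begin

definition taylor_coeff :: "(complex \<Rightarrow> complex) \<Rightarrow> nat \<Rightarrow> complex" where
  "taylor_coeff h n = (deriv ^^ n) h 0 / fact n"

(* Elements of H(D) are represented by functions on the whole complex plane whose values
   outside the open unit disc are irrelevant: membership in D2, the norm and the operator below
   depend only on the restriction to the disc. Sums over n \<ge> 1 are indexed by Suc n. *)

definition D2 :: "real \<Rightarrow> (complex \<Rightarrow> complex) set" where
  "D2 \<gamma> = {h. h holomorphic_on ball 0 1 \<and>
     summable (\<lambda>n. real (Suc n) powr (1 - \<gamma>) * (cmod (taylor_coeff h (Suc n)))\<^sup>2)}"

definition D2_norm :: "real \<Rightarrow> (complex \<Rightarrow> complex) \<Rightarrow> real" where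
  "D2_norm \<gamma> h = sqrt ((cmod (taylor_coeff h 0))\<^sup>2 +
     (\<Sum>n. real (Suc n) powr (1 - \<gamma>) * (cmod (taylor_coeff h (Suc n)))\<^sup>2))"

definition gen_hilbert :: "(complex \<Rightarrow> complex) \<Rightarrow> (complex \<Rightarrow> complex) \<Rightarrow> complex \<Rightarrow> complex" where
  "gen_hilbert g f z =
     (LINT t:{0..<1}|lborel. f (complex_of_real t) * deriv g (complex_of_real t * z))"

(* The natural domain of the operator: the Bochner integral above takes the value 0 on
   non-integrable functions, so integrability has to be required separately. *)
definition gen_hilbert_dom :: "(complex \<Rightarrow> complex) set" where
  "gen_hilbert_dom = {f. f holomorphic_on ball 0 1 \<and>
     set_integrable lborel {0..<1} (\<lambda>t. f (complex_of_real t))}"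

definition gen_hilbert_maps :: "(complex \<Rightarrow> complex) \<Rightarrow> real \<Rightarrow> real \<Rightarrow> bool" where
  "gen_hilbert_maps g \<alpha> \<beta> \<longleftrightarrow>
     D2 \<alpha> \<subseteq> gen_hilbert_dom \<and> (\<forall>f\<in>D2 \<alpha>. gen_hilbert g f \<in> D2 \<beta>)"

definition gen_hilbert_bounded :: "(complex \<Rightarrow> complex) \<Rightarrow> real \<Rightarrow> real \<Rightarrow> bool" where
  "gen_hilbert_bounded g \<alpha> \<beta> \<longleftrightarrow> gen_hilbert_maps g \<alpha> \<beta> \<and>
     (\<exists>C. \<forall>f\<in>D2 \<alpha>. D2_norm \<beta> (gen_hilbert g f) \<le> C * D2_norm \<alpha> f)"

(* Sequential form of compactness: images of norm-bounded sequences have subsequences that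
   converge in norm to an element of the target space. *)
definition gen_hilbert_compact :: "(complex \<Rightarrow> complex) \<Rightarrow> real \<Rightarrow> real \<Rightarrow> bool" where
  "gen_hilbert_compact g \<alpha> \<beta> \<longleftrightarrow> gen_hilbert_maps g \<alpha> \<beta> \<and>
     (\<forall>F :: nat \<Rightarrow> complex \<Rightarrow> complex.
        (\<forall>k. F k \<in> D2 \<alpha>) \<and> (\<exists>M. \<forall>k. D2_norm \<alpha> (F k) \<le> M) \<longrightarrow>
        (\<exists>r :: nat \<Rightarrow> nat. strict_mono r \<and>
          (\<exists>h\<in>D2 \<beta>. (\<lambda>k. D2_norm \<beta> (\<lambda>z. gen_hilbert g (F (r k)) z - h z)) \<longlonglongrightarrow> 0)))"

end

theory Submission
  imports Defs
begin

text \<open>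
  The \<open>n\<close>-th Taylor coefficient of \<open>H_g f\<close> is \<open>b_(n+1)\<close> times \<open>(n+1) m_n(f)\<close>, where
  \<open>m_n(f)\<close> is the \<open>n\<close>-th moment of \<open>f\<close> on \<open>[0,1)\<close>.  For \<open>\<alpha> < 0\<close> the Cauchy--Schwarz
  inequality bounds every \<open>f\<close> in the source space uniformly by a multiple of its norm, so the
  factors \<open>(n+1) m_n(f)\<close> are uniformly bounded and (3) implies (1).  Along a bounded sequence,
  a diagonal subsequence makes each of these factors converge, and dominated convergence for series
  turns this into norm convergence, so (3) implies (2).  Conversely, for \<open>f = 1\<close> all the
  factors are 1, and (3) just says that \<open>H_g 1\<close> lies in the target space.
\<close>

section \<open>The spaces \<open>D2\<close> as weighted l2 spaces of Taylor coefficients\<close>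

text \<open>The maximum provides the weight 1 at \<open>n = 0\<close>, where \<open>0 powr (1 - \<gamma>)\<close> would be 0.\<close>

definition D2_weight :: "real \<Rightarrow> nat \<Rightarrow> real" where
  "D2_weight \<gamma> n = real (max n 1) powr (1 - \<gamma>)"

lemma D2_weight_0 [simp]: "D2_weight \<gamma> 0 = 1"
  by (simp add: D2_weight_def)

lemma D2_weight_Suc: "D2_weight \<gamma> (Suc n) = real (Suc n) powr (1 - \<gamma>)"
  by (simp add: D2_weight_def)

lemma D2_weight_pos: "D2_weight \<gamma> n > 0"
  by (simp add: D2_weight_def)

lemma D2_iff_weight:
  "h \<in> D2 \<gamma> \<longleftrightarrow> h holomorphic_on ball 0 1 \<and>
     summable (\<lambda>n. D2_weight \<gamma> n * (cmod (taylor_coeff h n))\<^sup>2)"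
  by (subst summable_Suc_iff [symmetric]) (simp add: D2_def D2_weight_Suc)

lemma D2_norm_weight:
  assumes "h \<in> D2 \<gamma>"
  shows "D2_norm \<gamma> h = sqrt (\<Sum>n. D2_weight \<gamma> n * (cmod (taylor_coeff h n))\<^sup>2)"
proof -
  have "summable (\<lambda>n. D2_weight \<gamma> n * (cmod (taylor_coeff h n))\<^sup>2)"
    using assms by (simp add: D2_iff_weight)
  from suminf_split_head [OF this] show ?thesis
    by (simp add: D2_norm_def D2_weight_Suc)
qed

lemma D2_weight_summable:
  assumes "h \<in> D2 \<gamma>"
  shows "summable (\<lambda>n. D2_weight \<gamma> n * (cmod (taylor_coeff h n))\<^sup>2)"
  using assms by (simp add: D2_iff_weight)

section \<open>Power series on the unit disc\<close>

text \<open>Uniqueness of the expansion at 0. It links series identities on the disc with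
  \<open>taylor_coeff\<close>, which is defined through derivatives at 0, and so gives access to
  norms in \<open>D2\<close>.\<close>

lemma taylor_coeff_power_series:
  assumes "\<And>z. z \<in> ball 0 1 \<Longrightarrow> (\<lambda>n. c n * z ^ n) sums h z"
  shows "taylor_coeff h n = c n"
proof -
  have "conv_radius c \<ge> ereal 1"
  proof (rule conv_radius_geI_ex')
    fix r :: real assume "0 < r" "ereal r < ereal 1"
    then show "summable (\<lambda>n. c n * of_real r ^ n)"
      using assms[of "of_real r"] by (auto simp: sums_iff)
  qed
  then have "fps_conv_radius (Abs_fps c) > 0"
    by (auto simp: fps_conv_radius_def zero_ereal_def intro: less_le_trans [rotated])
  moreover have "eventually (\<lambda>z. eval_fps (Abs_fps c) z = h z) (nhds 0)"
  proof (rule eventually_mono)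
    show "\<forall>\<^sub>F z in nhds 0. z \<in> ball (0::complex) 1"
      by (rule eventually_nhds_in_open) auto
  qed (use assms in \<open>auto simp: eval_fps_def sums_iff\<close>)
  ultimately have "h has_fps_expansion Abs_fps c"
    by (simp add: has_fps_expansion_def)
  from fps_nth_fps_expansion [OF this, of n] show ?thesis
    by (simp add: taylor_coeff_def)
qed

lemma holomorphic_on_unit_disc_power_series:
  assumes "\<And>z. z \<in> ball 0 1 \<Longrightarrow> (\<lambda>n. c n * z ^ n) sums h z"
  shows "h holomorphic_on ball 0 1"
  by (rule power_series_holomorphic [where a = c]) (use assms in simp)

text \<open>Abel's lemma: convergence at some radius strictly between \<open>cmod z\<close> and 1
  forces absolute convergence at \<open>z\<close>.\<close>

lemma summable_norm_unit_disc_power_series: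
  fixes z :: complex
  assumes c: "\<And>w. w \<in> ball 0 1 \<Longrightarrow> summable (\<lambda>n. c n * w ^ n)" and z: "z \<in> ball 0 1"
  shows "summable (\<lambda>n. cmod (c n * z ^ n))"
proof -
  obtain r where "cmod z < r" "r < 1"
    using z dense by auto
  moreover from this have "0 < r"
    using norm_ge_zero [of z] by linarith
  ultimately show ?thesis
    using c by (intro powser_insidea [of _ "of_real r"]) auto
qed

lemma taylor_coeff_sums:
  assumes "h holomorphic_on ball 0 1" "z \<in> ball 0 1"
  shows "(\<lambda>n. taylor_coeff h n * z ^ n) sums h z"
  using holomorphic_power_series [OF assms] by (simp add: taylor_coeff_def)

section \<open>Boundedness and integrability of functions in \<open>D2 \<alpha>\<close> for \<alpha>
  < 0\<close>

text \<open>For positive index the inverse weight is a power with exponent \<alpha> - 1, and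
  \<alpha> < 0 places this exponent below -1.\<close>

lemma summable_inverse_D2_weight:
  assumes "\<alpha> < 0"
  shows "summable (\<lambda>n. inverse (D2_weight \<alpha> n))"
proof (subst summable_Suc_iff [symmetric])
  have "summable (\<lambda>n. real (Suc n) powr (\<alpha> - 1))"
    using assms by (subst summable_Suc_iff) (simp add: summable_real_powr_iff)
  then show "summable (\<lambda>n. inverse (D2_weight \<alpha> (Suc n)))"
    by (simp add: D2_weight_Suc powr_minus [symmetric])
qed

text \<open>Since powers of \<open>cmod z\<close> are at most 1, partial sums are bounded by sums of
  \<open>cmod (?c n)\<close>. Weighted Cauchy-Schwarz bounds these independently of \<open>z\<close>
  and \<open>N\<close>, and the bound survives the limit.\<close>

lemma D2_pointwise_bound:
  assumes "\<alpha> < 0" "f \<in> D2 \<alpha>" "z \<in> ball 0 1"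
  shows "cmod (f z) \<le> sqrt (\<Sum>n. inverse (D2_weight \<alpha> n)) * D2_norm \<alpha> f"
proof (rule Lim_bounded)
  let ?w = "D2_weight \<alpha>" and ?c = "taylor_coeff f"
  have "(\<lambda>n. ?c n * z ^ n) sums f z"
    using assms by (intro taylor_coeff_sums) (simp_all add: D2_def)
  then show "(\<lambda>N. cmod (\<Sum>n<N. ?c n * z ^ n)) \<longlonglongrightarrow> cmod (f z)"
    by (auto simp: sums_def intro: tendsto_norm)
  have "cmod (\<Sum>n<N. ?c n * z ^ n) \<le> sqrt (\<Sum>n. inverse (?w n)) * D2_norm \<alpha> f" for N
  proof -
    have "cmod (\<Sum>n<N. ?c n * z ^ n) \<le> (\<Sum>n<N. cmod (?c n))"
    proof (rule sum_norm_le)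
      fix n
      have "cmod z ^ n \<le> 1"
        using assms(3) by (simp add: power_le_one)
      then show "cmod (?c n * z ^ n) \<le> cmod (?c n)"
        by (simp add: norm_mult norm_power mult_left_le)
    qed
    \<comment> \<open>Insert 1 as the product of the square roots of the inverse weight and of the
      weight; the absolute values match the form of \<open>L2_set_mult_ineq\<close>.\<close>
    also have "\<dots> = (\<Sum>n<N. \<bar>sqrt (inverse (?w n))\<bar> * \<bar>sqrt (?w n) * cmod (?c n)\<bar>)"
      by (rule sum.cong)
        (simp_all add: abs_mult real_sqrt_inverse D2_weight_pos less_imp_neq [OF D2_weight_pos, symmetric])
    also have "\<dots> \<le> sqrt (\<Sum>n<N. inverse (?w n)) * sqrt (\<Sum>n<N. ?w n * (cmod (?c n))\<^sup>2)"
      using L2_set_mult_ineq [of "\<lambda>n. sqrt (inverse (?w n))" "\<lambda>n. sqrt (?w n) * cmod (?c n)" "{..<N}"]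
      by (simp add: L2_set_def power_mult_distrib less_imp_le [OF D2_weight_pos])
    also have "\<dots> \<le> sqrt (\<Sum>n. inverse (?w n)) * D2_norm \<alpha> f"
      unfolding D2_norm_weight [OF assms(2)]
      by (intro mult_mono real_sqrt_le_mono sum_le_suminf D2_weight_summable assms
          summable_inverse_D2_weight real_sqrt_ge_zero suminf_nonneg sum_nonneg)
        (simp_all add: less_imp_le [OF D2_weight_pos])
    finally show ?thesis .
  qed
  then show "\<forall>N\<ge>0. cmod (\<Sum>n<N. ?c n * z ^ n) \<le> sqrt (\<Sum>n. inverse (?w n)) * D2_norm \<alpha> f"
    by blast
qed

lemma D2_subset_gen_hilbert_dom:
  assumes "\<alpha> < 0"
  shows "D2 \<alpha> \<subseteq> gen_hilbert_dom"
proof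
  fix f assume f: "f \<in> D2 \<alpha>"
  then have holo: "f holomorphic_on ball 0 1"
    by (simp add: D2_def)
  have "continuous_on {0..<1} (\<lambda>t::real. f (of_real t))"
    by (rule continuous_on_compose2 [OF holomorphic_on_imp_continuous_on [OF holo]])
      (auto intro!: continuous_intros)
  then have meas: "(\<lambda>t. indicator {0..<1} t *\<^sub>R f (complex_of_real t)) \<in> borel_measurable borel"
    by (intro borel_measurable_continuous_on_indicator) simp_all
  \<comment> \<open>The indicator appears twice: the rule supplies the outer one but asks for a
    globally measurable function, and \<open>f\<close> is arbitrary outside the disc, so the inner
    one is needed too.\<close>
  have "integrable lborel (\<lambda>t. indicator {0..<1} t *\<^sub>R (indicator {0..<1} t *\<^sub>R f (complex_of_real t)))"
    by (rule integrableI_bounded_set_indicator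
        [where B = "sqrt (\<Sum>n. inverse (D2_weight \<alpha> n)) * D2_norm \<alpha> f"])
      (use meas D2_pointwise_bound [OF assms f] in auto)
  then have "set_integrable lborel {0..<1} (\<lambda>t. f (complex_of_real t))"
    unfolding set_integrable_def
    by (rule Bochner_Integration.integrable_cong [OF refl, THEN iffD1, rotated]) (simp add: indicator_def)
  with holo show "f \<in> gen_hilbert_dom"
    by (simp add: gen_hilbert_dom_def)
qed

section \<open>Moments on [0,1)\<close>

definition moment :: "(complex \<Rightarrow> complex) \<Rightarrow> nat \<Rightarrow> complex" where
  "moment f n = (LINT t:{0..<1}|lborel. f (complex_of_real t) * complex_of_real t ^ n)"

lemma set_integrable_moment:
  assumes "f \<in> gen_hilbert_dom"
  shows "set_integrable lborel {0..<1} (\<lambda>t. f (complex_of_real t) * complex_of_real t ^ n)"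
proof (rule set_integrable_bound)
  show f: "set_integrable lborel {0..<1} (\<lambda>t. f (complex_of_real t))"
    using assms by (simp add: gen_hilbert_dom_def)
  have "(\<lambda>t. (indicator {0..<1} t *\<^sub>R f (complex_of_real t)) * complex_of_real t ^ n)
          \<in> borel_measurable lborel"
    using f by (intro borel_measurable_times borel_measurable_power)
      (auto simp: set_integrable_def dest: borel_measurable_integrable)
  then show "set_borel_measurable lborel {0..<1} (\<lambda>t. f (complex_of_real t) * complex_of_real t ^ n)"
    by (simp add: set_borel_measurable_def)
  show "AE t in lborel. t \<in> {0..<1} \<longrightarrow>
      norm (f (complex_of_real t) * complex_of_real t ^ n) \<le> norm (f (complex_of_real t))"
    by (auto simp: norm_mult norm_power intro!: mult_left_le power_le_one)
qed

lemma set_integral_power_unit: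
  "set_integrable lborel {0..<1} (\<lambda>t::real. t ^ n)"
  "(LINT t:{0..<1}|lborel. t ^ n) = 1 / real (Suc n)"
proof -
  \<comment> \<open>The half-open and the closed interval differ only in the null set {1}, so the
    results for compact intervals carry over.\<close>
  have ae: "AE t in lborel. indicator {0..<1} t *\<^sub>R t ^ n = t ^ n * indicator {0..1::real} t"
    using AE_lborel_singleton [of 1]
    by eventually_elim (auto simp: indicator_def)
  have "integrable lborel (\<lambda>t. indicator {0..1::real} t *\<^sub>R t ^ n)"
    by (rule borel_integrable_compact) (auto intro!: continuous_intros)
  then show "set_integrable lborel {0..<1} (\<lambda>t::real. t ^ n)"
    unfolding set_integrable_def
    by (subst integrable_cong_AE [OF _ _ ae]) (simp_all add: mult.commute)
  have "(LINT t:{0..<1}|lborel. t ^ n) = (\<integral>t. t ^ n * indicator {0..1::real} t \<partial>lborel)"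
    unfolding set_lebesgue_integral_def
    by (rule integral_cong_AE [OF _ _ ae]) simp_all
  then show "(LINT t:{0..<1}|lborel. t ^ n) = 1 / real (Suc n)"
    by (simp add: integral_power)
qed

lemma moment_one: "moment (\<lambda>_. 1) n = 1 / of_nat (Suc n)"
proof -
  have "moment (\<lambda>_. 1) n = (LINT t:{0..<1}|lborel. complex_of_real (t ^ n))"
    by (simp add: moment_def)
  also have "\<dots> = complex_of_real (LINT t:{0..<1}|lborel. t ^ n)"
    by (rule set_integral_complex_of_real)
  finally show ?thesis
    by (simp add: set_integral_power_unit)
qed

text \<open>The factor \<open>Suc n\<close> exactly cancels the integral of \<open>t ^ n\<close>, so
  a sup bound on \<open>f\<close> passes to every scaled moment with the same constant.\<close>

lemma norm_moment_le:
  assumes "f \<in> gen_hilbert_dom" "\<And>z. z \<in> ball 0 1 \<Longrightarrow> cmod (f z) \<le> B"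
  shows "cmod (of_nat (Suc n) * moment f n) \<le> B"
proof -
  have "cmod (moment f n) \<le> (LINT t:{0..<1}|lborel. cmod (f (complex_of_real t) * complex_of_real t ^ n))"
    unfolding moment_def by (rule set_integral_norm_bound [OF set_integrable_moment [OF assms(1)]])
  also have "\<dots> \<le> (LINT t:{0..<1}|lborel. B * t ^ n)"
    by (rule set_integral_mono [OF set_integrable_norm [OF set_integrable_moment [OF assms(1)]]])
      (auto simp: norm_mult norm_power intro!: mult_right_mono assms set_integral_power_unit)
  also have "\<dots> = B / real (Suc n)"
    by (simp add: set_integral_power_unit)
  finally have "real (Suc n) * cmod (moment f n) \<le> B"
    by (simp add: field_simps)
  then show ?thesis
    by (simp only: norm_mult norm_of_nat)
qed

section \<open>Taylor expansion of the image of \<open>f\<close>\<close>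

text \<open>Expand g'(tz) in powers of tz and integrate term by term. As t^n \<le> 1, each term is
  at most |f(t)| times a term of the absolutely convergent series of g'(z), so integrability of
  \<open>f\<close> justifies the exchange.\<close>

lemma gen_hilbert_sums:
  assumes g: "\<And>z. z \<in> ball 0 1 \<Longrightarrow> (\<lambda>n. b n * z ^ n) sums g z"
    and f: "f \<in> gen_hilbert_dom" and z: "z \<in> ball 0 1"
  shows "(\<lambda>n. b (Suc n) * (of_nat (Suc n) * moment f n) * z ^ n) sums gen_hilbert g f z"
proof -
  let ?J = "{0..<1::real}"
  have deriv: "(\<lambda>n. diffs b n * w ^ n) sums deriv g w" if "w \<in> ball 0 1" for w
  proof (rule termdiffs_sums_strong [where K = 1 and f = g])
    show "(g has_field_derivative deriv g w) (at w)"
      using holomorphic_on_unit_disc_power_series [OF g] that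
      by (auto intro: holomorphic_derivI)
  qed (use g that in auto)
  \<comment> \<open>\<open>diffs b n\<close> is (n+1) b_(n+1). Keeping
    \<open>diffs b n * z ^ n\<close> as a separate factor free of \<open>t\<close> leaves exactly
    the moment under the integral.\<close>
  let ?u = "\<lambda>n t. indicator ?J t *\<^sub>R (f (of_real t) * of_real t ^ n) * (diffs b n * z ^ n)"
  have abs: "summable (\<lambda>n. cmod (diffs b n * z ^ n))"
    by (rule summable_norm_unit_disc_power_series [OF sums_summable [OF deriv] z])
  have int_u: "integrable lborel (?u n)" for n
    using set_integrable_moment [OF f, of n] unfolding set_integrable_def
    by (rule integrable_mult_left)
  have bound: "cmod (?u n t) \<le> cmod (indicator ?J t *\<^sub>R f (of_real t)) * cmod (diffs b n * z ^ n)" for n t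
    by (auto simp: indicator_def norm_mult norm_power intro!: mult_right_mono mult_left_le power_le_one)
  have int_f: "integrable lborel (\<lambda>t. indicator ?J t *\<^sub>R f (complex_of_real t))"
    using f by (simp add: gen_hilbert_dom_def set_integrable_def)
  have "(\<lambda>n. \<integral>t. ?u n t \<partial>lborel) sums (\<integral>t. (\<Sum>n. ?u n t) \<partial>lborel)"
  proof (rule sums_integral [OF int_u])
    show "AE t in lborel. summable (\<lambda>n. cmod (?u n t))"
      by (rule AE_I2, rule summable_comparison_test' [OF summable_mult [OF abs]])
        (use bound in simp)
    have "norm (\<integral>t. cmod (?u n t) \<partial>lborel) \<le>
        (\<integral>t. cmod (indicator ?J t *\<^sub>R f (of_real t)) \<partial>lborel) * cmod (diffs b n * z ^ n)" for n
    proof -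
      have "(\<integral>t. cmod (?u n t) \<partial>lborel) \<le>
          (\<integral>t. cmod (indicator ?J t *\<^sub>R f (of_real t)) * cmod (diffs b n * z ^ n) \<partial>lborel)"
        by (intro integral_mono integrable_norm int_u integrable_mult_left int_f bound)
      then show ?thesis
        by simp
    qed
    then show "summable (\<lambda>n. \<integral>t. cmod (?u n t) \<partial>lborel)"
      by (rule summable_comparison_test' [OF summable_mult [OF abs]])
  qed
  moreover have "(\<integral>t. ?u n t \<partial>lborel) = b (Suc n) * (of_nat (Suc n) * moment f n) * z ^ n" for n
    unfolding integral_mult_left_zero
    by (simp add: moment_def set_lebesgue_integral_def diffs_def mult_ac)
  moreover have "(\<Sum>n. ?u n t) = indicator ?J t *\<^sub>R (f (of_real t) * deriv g (of_real t * z))" for t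
  proof (cases "t \<in> ?J")
    case True
    then have "cmod (of_real t * z) < 1"
      using z mult_left_le_one_le [of "cmod z" t] by (simp add: norm_mult)
    then have "(\<lambda>n. f (of_real t) * (diffs b n * (of_real t * z) ^ n)) sums
        (f (of_real t) * deriv g (of_real t * z))"
      by (intro sums_mult deriv) simp
    then show ?thesis
      using True by (simp add: sums_iff power_mult_distrib mult_ac)
  qed simp
  ultimately show ?thesis
    by (simp add: gen_hilbert_def set_lebesgue_integral_def)
qed

section \<open>The index shift in the weights\<close>

text \<open>The numbers max n 1 and n+1 differ by a factor of at most 2, which changes a power with
  exponent s by a factor of at most 2^|s|.\<close>

lemma D2_weight_shift_bounds:
  "D2_weight \<gamma> n \<le> 2 powr \<bar>1 - \<gamma>\<bar> * real (Suc n) powr (1 - \<gamma>)"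
  "real (Suc n) powr (1 - \<gamma>) \<le> 2 powr \<bar>1 - \<gamma>\<bar> * D2_weight \<gamma> n"
proof -
  \<comment> \<open>Both comparisons of x and y are assumed because the sign of s is open: x \<le>
    2y serves s \<ge> 0, and x \<ge> y/2 serves s < 0, where the power is decreasing.\<close>
  have *: "x powr s \<le> 2 powr \<bar>s\<bar> * y powr s" if "0 < x" "0 < y" "x \<le> 2 * y" "y \<le> 2 * x" for x y s :: real
  proof (cases "s \<ge> 0")
    case True
    then have "x powr s \<le> (2 * y) powr s"
      using that by (intro powr_mono2) auto
    then show ?thesis
      using True that by (simp add: powr_mult)
  next
    case False
    then have "x powr s \<le> (y / 2) powr s"
      using that by (intro powr_mono2') auto
    also have "\<dots> = 2 powr \<bar>s\<bar> * y powr s"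
      using False that by (simp add: powr_divide powr_minus field_simps)
    finally show ?thesis .
  qed
  show "D2_weight \<gamma> n \<le> 2 powr \<bar>1 - \<gamma>\<bar> * real (Suc n) powr (1 - \<gamma>)"
    "real (Suc n) powr (1 - \<gamma>) \<le> 2 powr \<bar>1 - \<gamma>\<bar> * D2_weight \<gamma> n"
    unfolding D2_weight_def by (rule *; auto simp: max_def)+
qed

text \<open>In the image, b_(n+1) sits at index n and carries the weight of n, whereas statement (3)
  gives it the weight of n+1.\<close>

lemma summable_D2_weight_shift:
  "summable (\<lambda>n. D2_weight \<gamma> n * (cmod (b (Suc n)))\<^sup>2) \<longleftrightarrow>
     summable (\<lambda>n. real (Suc n) powr (1 - \<gamma>) * (cmod (b (Suc n)))\<^sup>2)" (is "?L \<longleftrightarrow> ?R")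
proof
  assume ?L
  from summable_mult [OF this, of "2 powr \<bar>1 - \<gamma>\<bar>"] show ?R
    by (rule summable_comparison_test' [where N = 0])
      (use D2_weight_shift_bounds(2) in
        \<open>auto simp: mult.assoc [symmetric] simp del: of_nat_Suc intro!: mult_right_mono\<close>)
next
  assume ?R
  from summable_mult [OF this, of "2 powr \<bar>1 - \<gamma>\<bar>"] show ?L
    by (rule summable_comparison_test' [where N = 0])
      (use D2_weight_shift_bounds(1) less_imp_le [OF D2_weight_pos] in
        \<open>auto simp: mult.assoc [symmetric] simp del: of_nat_Suc intro!: mult_right_mono\<close>)
qed

section \<open>Necessity of the coefficient condition\<close>

lemma one_mem_D2: "(\<lambda>_. 1) \<in> D2 \<gamma>"
proof -
  have "(\<lambda>n. (if n = 0 then 1 else 0) * z ^ n) sums 1" for z :: complex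
    using sums_single [of 0 "\<lambda>_. 1 :: complex"]
    by (rule back_subst [of "\<lambda>s. s sums 1"]) (simp add: fun_eq_iff)
  then have "taylor_coeff (\<lambda>_. 1) n = (if n = 0 then 1 else 0)" for n
    by (rule taylor_coeff_power_series)
  then show ?thesis
    by (simp add: D2_def)
qed

text \<open>Testing on the constant 1 needs only the mapping property, so the argument serves
  boundedness and compactness alike.\<close>

lemma gen_hilbert_maps_imp_summable:
  assumes g: "\<And>z. z \<in> ball 0 1 \<Longrightarrow> (\<lambda>n. b n * z ^ n) sums g z"
    and maps: "gen_hilbert_maps g \<alpha> \<beta>"
  shows "summable (\<lambda>n. D2_weight \<beta> n * (cmod (b (Suc n)))\<^sup>2)"
proof -
  have one: "(\<lambda>_. 1) \<in> gen_hilbert_dom" "gen_hilbert g (\<lambda>_. 1) \<in> D2 \<beta>"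
    using maps one_mem_D2 [of \<alpha>] by (auto simp: gen_hilbert_maps_def)
  have "taylor_coeff (gen_hilbert g (\<lambda>_. 1)) n = b (Suc n)" for n
    by (subst taylor_coeff_power_series [OF gen_hilbert_sums [OF g one(1)]])
      (simp_all add: moment_one del: of_nat_Suc)
  with D2_weight_summable [OF one(2)] show ?thesis
    by simp
qed

section \<open>Sufficiency: bounded multipliers, boundedness and compactness\<close>

text \<open>Images under the operator, their limit and the differences between them all have
  coefficients b_(n+1) times a bounded factor, so one lemma treats them all. The exact norm serves
  compactness, the estimate boundedness.\<close>

lemma D2_multiplier:
  assumes h: "\<And>z. z \<in> ball 0 1 \<Longrightarrow> (\<lambda>n. b (Suc n) * \<mu> n * z ^ n) sums h z"
    and b: "summable (\<lambda>n. D2_weight \<beta> n * (cmod (b (Suc n)))\<^sup>2)"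
    and B: "\<And>n. cmod (\<mu> n) \<le> B"
  shows "h \<in> D2 \<beta>"
    and "D2_norm \<beta> h = sqrt (\<Sum>n. D2_weight \<beta> n * (cmod (b (Suc n)))\<^sup>2 * (cmod (\<mu> n))\<^sup>2)"
    and "D2_norm \<beta> h \<le> sqrt (\<Sum>n. D2_weight \<beta> n * (cmod (b (Suc n)))\<^sup>2) * B"
proof -
  let ?d = "\<lambda>n. D2_weight \<beta> n * (cmod (b (Suc n)))\<^sup>2"
  have d: "?d n \<ge> 0" for n
    by (simp add: less_imp_le [OF D2_weight_pos])
  have coeff: "D2_weight \<beta> n * (cmod (taylor_coeff h n))\<^sup>2 = ?d n * (cmod (\<mu> n))\<^sup>2" for n
    by (subst taylor_coeff_power_series [OF h]) (simp_all add: norm_mult power_mult_distrib)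
  have le: "?d n * (cmod (\<mu> n))\<^sup>2 \<le> ?d n * B\<^sup>2" for n
    using B [of n] by (intro mult_left_mono d power_mono) auto
  have sum: "summable (\<lambda>n. ?d n * (cmod (\<mu> n))\<^sup>2)"
    by (rule summable_comparison_test' [OF summable_mult2 [OF b, of "B\<^sup>2"], of 0])
      (use le in \<open>simp add: abs_mult less_imp_le [OF D2_weight_pos]\<close>)
  show mem: "h \<in> D2 \<beta>"
    using sum holomorphic_on_unit_disc_power_series [OF h] by (simp add: D2_iff_weight coeff)
  show eq: "D2_norm \<beta> h = sqrt (\<Sum>n. ?d n * (cmod (\<mu> n))\<^sup>2)"
    by (simp add: D2_norm_weight [OF mem] coeff)
  have "B \<ge> 0"
    using B [of 0] norm_ge_zero order_trans by blast
  have "(\<Sum>n. ?d n * (cmod (\<mu> n))\<^sup>2) \<le> (\<Sum>n. ?d n * B\<^sup>2)"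
    by (intro suminf_le le sum summable_mult2 b)
  also have "\<dots> = (\<Sum>n. ?d n) * B\<^sup>2"
    by (rule suminf_mult2 [OF b, symmetric])
  finally show "D2_norm \<beta> h \<le> sqrt (\<Sum>n. ?d n) * B"
    using \<open>B \<ge> 0\<close> real_sqrt_le_mono by (fastforce simp: eq real_sqrt_mult)
qed

lemma norm_moment_le_D2_norm:
  assumes "\<alpha> < 0" "f \<in> D2 \<alpha>"
  shows "cmod (of_nat (Suc n) * moment f n) \<le> sqrt (\<Sum>n. inverse (D2_weight \<alpha> n)) * D2_norm \<alpha> f"
  using assms D2_subset_gen_hilbert_dom by (intro norm_moment_le D2_pointwise_bound) auto

lemma summable_imp_gen_hilbert_bounded:
  assumes g: "\<And>z. z \<in> ball 0 1 \<Longrightarrow> (\<lambda>n. b n * z ^ n) sums g z"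
    and b: "summable (\<lambda>n. D2_weight \<beta> n * (cmod (b (Suc n)))\<^sup>2)" and "\<alpha> < 0"
  shows "gen_hilbert_bounded g \<alpha> \<beta>"
proof -
  note dom = D2_subset_gen_hilbert_dom [OF \<open>\<alpha> < 0\<close>]
  have *: "gen_hilbert g f \<in> D2 \<beta> \<and> D2_norm \<beta> (gen_hilbert g f) \<le>
      sqrt (\<Sum>n. D2_weight \<beta> n * (cmod (b (Suc n)))\<^sup>2) *
      sqrt (\<Sum>n. inverse (D2_weight \<alpha> n)) * D2_norm \<alpha> f"
    if "f \<in> D2 \<alpha>" for f
    using D2_multiplier(1,3) [OF gen_hilbert_sums [OF g] b norm_moment_le_D2_norm [OF \<open>\<alpha> < 0\<close> that]]
      dom that by (auto simp: mult.assoc)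
  then show ?thesis
    using dom unfolding gen_hilbert_bounded_def gen_hilbert_maps_def by blast
qed

lemma summable_imp_gen_hilbert_compact:
  assumes g: "\<And>z. z \<in> ball 0 1 \<Longrightarrow> (\<lambda>n. b n * z ^ n) sums g z"
    and b: "summable (\<lambda>n. D2_weight \<beta> n * (cmod (b (Suc n)))\<^sup>2)" and "\<alpha> < 0"
  shows "gen_hilbert_compact g \<alpha> \<beta>"
  unfolding gen_hilbert_compact_def
proof (intro conjI allI impI; (elim conjE exE)?)
  show "gen_hilbert_maps g \<alpha> \<beta>"
    using summable_imp_gen_hilbert_bounded [OF assms] by (simp add: gen_hilbert_bounded_def)
next
  fix F :: "nat \<Rightarrow> complex \<Rightarrow> complex" and M
  assume F: "\<forall>k. F k \<in> D2 \<alpha>" and M: "\<forall>k. D2_norm \<alpha> (F k) \<le> M"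
  define m where "m k n = of_nat (Suc n) * moment (F k) n" for k n
  define B where "B = sqrt (\<Sum>n. inverse (D2_weight \<alpha> n)) * M"
  have sums_F: "(\<lambda>n. b (Suc n) * m k n * z ^ n) sums gen_hilbert g (F k) z" if "z \<in> ball 0 1" for k z
    unfolding m_def using F D2_subset_gen_hilbert_dom [OF \<open>\<alpha> < 0\<close>] that
    by (intro gen_hilbert_sums g) auto
  have m_le: "cmod (m k n) \<le> B" for k n
  proof -
    have "cmod (m k n) \<le> sqrt (\<Sum>n. inverse (D2_weight \<alpha> n)) * D2_norm \<alpha> (F k)"
      unfolding m_def using F by (intro norm_moment_le_D2_norm \<open>\<alpha> < 0\<close>) auto
    also have "\<dots> \<le> B"
      unfolding B_def using M
      by (intro mult_left_mono real_sqrt_ge_zero suminf_nonneg summable_inverse_D2_weight \<open>\<alpha> < 0\<close>)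
        (auto simp: less_imp_le [OF D2_weight_pos])
    finally show ?thesis .
  qed
  \<comment> \<open>Diagonal argument: one subsequence makes the multipliers converge for all
    \<open>n\<close> at once, each sequence being bounded by \<open>B\<close>.\<close>
  obtain r :: "nat \<Rightarrow> nat" where r: "strict_mono r" "\<And>n. \<exists>l. (\<lambda>k. m (r k) n) \<longlonglongrightarrow> l"
    using function_convergent_subsequence [of UNIV m B] m_le by auto
  then obtain \<mu> where \<mu>: "\<And>n. (\<lambda>k. m (r k) n) \<longlonglongrightarrow> \<mu> n"
    by metis
  have \<mu>_le: "cmod (\<mu> n) \<le> B" for n
    by (rule Lim_bounded [OF tendsto_norm [OF \<mu>], of 0]) (use m_le in auto)
  \<comment> \<open>The candidate limit has the limiting multipliers; it converges on the disc by
    comparison with the series of \<open>b (Suc n)\<close>, since \<open>\<mu>\<close> is bounded by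
    \<open>B\<close>.\<close>
  define h where "h z = (\<Sum>n. b (Suc n) * \<mu> n * z ^ n)" for z
  have sums_h: "(\<lambda>n. b (Suc n) * \<mu> n * z ^ n) sums h z" if z: "z \<in> ball 0 1" for z
  proof -
    have "summable (\<lambda>n. b (Suc n) * w ^ n)" if "w \<in> ball 0 1" for w
      using g [OF that] by (intro powser_split_head) (rule sums_summable)
    then have "summable (\<lambda>n. cmod (b (Suc n) * z ^ n))"
      by (rule summable_norm_unit_disc_power_series [OF _ z])
    then have "summable (\<lambda>n. b (Suc n) * \<mu> n * z ^ n)"
      by (rule summable_comparison_test' [OF summable_mult2 [where c = B]])
        (use \<mu>_le in \<open>auto simp: norm_mult mult_ac intro!: mult_right_mono\<close>)
    then show ?thesis
      by (simp add: h_def summable_sums)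
  qed
  let ?d = "\<lambda>n. D2_weight \<beta> n * (cmod (b (Suc n)))\<^sup>2"
  have diff: "cmod (m k n - \<mu> n) \<le> 2 * B" for k n
    using norm_triangle_ineq4 [of "m k n" "\<mu> n"] m_le [of k n] \<mu>_le [of n] by linarith
  have sums_gap: "(\<lambda>n. b (Suc n) * (m k n - \<mu> n) * z ^ n) sums (gen_hilbert g (F k) z - h z)"
    if "z \<in> ball 0 1" for k z
    using sums_diff [OF sums_F [OF that] sums_h [OF that]] by (simp only: ring_distribs)
  have norm_diff: "D2_norm \<beta> (\<lambda>z. gen_hilbert g (F k) z - h z) =
      sqrt (\<Sum>n. ?d n * (cmod (m k n - \<mu> n))\<^sup>2)" for k
    by (rule D2_multiplier(2) [OF sums_gap b diff])
  \<comment> \<open>Dominated convergence for series: each term tends to 0, and \<open>diff\<close>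
    yields the majorant \<open>?d n * (2 * B)\<^sup>2\<close>, independent of \<open>k\<close> and
    summable by \<open>b\<close>.\<close>
  have "(\<lambda>k. \<Sum>n. ?d n * (cmod (m (r k) n - \<mu> n))\<^sup>2) \<longlonglongrightarrow> (\<Sum>n. 0)"
  proof (rule tannerys_theorem [THEN conjunct2, THEN conjunct2])
    show "(\<lambda>k. ?d n * (cmod (m (r k) n - \<mu> n))\<^sup>2) \<longlonglongrightarrow> 0" for n
      using \<mu> [of n] by (auto intro!: tendsto_eq_intros)
    show "summable (\<lambda>n. ?d n * (2 * B)\<^sup>2)"
      by (rule summable_mult2 [OF b])
    have "?d n * (cmod (m k n - \<mu> n))\<^sup>2 \<le> ?d n * (2 * B)\<^sup>2" for k n
      by (intro mult_left_mono power_mono diff) (simp_all add: less_imp_le [OF D2_weight_pos])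
    then show "\<forall>\<^sub>F (n, k) in at_top \<times>\<^sub>F sequentially.
        norm (?d n * (cmod (m (r k) n - \<mu> n))\<^sup>2) \<le> ?d n * (2 * B)\<^sup>2"
      by (intro always_eventually) (simp add: abs_mult less_imp_le [OF D2_weight_pos])
  qed simp
  then have "(\<lambda>k. D2_norm \<beta> (\<lambda>z. gen_hilbert g (F (r k)) z - h z)) \<longlonglongrightarrow> 0"
    unfolding norm_diff by (rule tendsto_real_sqrt [THEN tendsto_eq_rhs]) simp
  moreover have "h \<in> D2 \<beta>"
    by (rule D2_multiplier(1) [OF sums_h b \<mu>_le])
  ultimately show "\<exists>r. strict_mono r \<and>
      (\<exists>h\<in>D2 \<beta>. (\<lambda>k. D2_norm \<beta> (\<lambda>z. gen_hilbert g (F (r k)) z - h z)) \<longlonglongrightarrow> 0)"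
    using r(1) by blast
qed

theorem corollary2p8:
  fixes g :: "complex \<Rightarrow> complex" and b :: "nat \<Rightarrow> complex" and \<alpha> \<beta> :: real
  assumes "g holomorphic_on ball 0 1"
    and "\<And>z. z \<in> ball 0 1 \<Longrightarrow> (\<lambda>n. b n * z ^ n) sums g z"
    and "\<alpha> < 0"
  shows "(gen_hilbert_bounded g \<alpha> \<beta> \<longleftrightarrow> gen_hilbert_compact g \<alpha> \<beta>) \<and>
         (gen_hilbert_compact g \<alpha> \<beta> \<longleftrightarrow>
            summable (\<lambda>n. real (Suc n) powr (1 - \<beta>) * (cmod (b (Suc n)))\<^sup>2))"
proof -
  \<comment> \<open>\<open>?S\<close> is condition (3) with the shifted weight. Both operator
    properties are matched with it, and the shift is undone at the end.\<close>
  let ?S = "summable (\<lambda>n. D2_weight \<beta> n * (cmod (b (Suc n)))\<^sup>2)"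
  have "gen_hilbert_bounded g \<alpha> \<beta> \<longleftrightarrow> ?S"
    using gen_hilbert_maps_imp_summable [OF assms(2)]
      summable_imp_gen_hilbert_bounded [OF assms(2) _ assms(3)]
    unfolding gen_hilbert_bounded_def by meson
  moreover have "gen_hilbert_compact g \<alpha> \<beta> \<longleftrightarrow> ?S"
  proof
    assume "gen_hilbert_compact g \<alpha> \<beta>"
    then have "gen_hilbert_maps g \<alpha> \<beta>"
      unfolding gen_hilbert_compact_def by (rule conjunct1)
    then show ?S
      by (rule gen_hilbert_maps_imp_summable [OF assms(2), rotated])
  qed (rule summable_imp_gen_hilbert_compact [OF assms(2) _ assms(3)])
  ultimately show ?thesis
    by (simp only: summable_D2_weight_shift)
qed

end
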